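(* Let $(X_1,Y_1),\dots,(X_4,Y_4)$ be i.i.d. pairs of random vectors from a joint distribution $P_{XY}$, with $X\in\mathbb{R}^p$ and $Y\in\mathbb{R}^q$, such that $\alpha^\top X$ and $\beta^\top Y$ have continuous distribution functions for $\lambda$-almost all $\alpha\in\mathbb{S}^{p-1}$ and $\lambda$-almost all $\beta\in\mathbb{S}^{q-1}$. Then $$\int_{\mathbb{S}^{p-1}}\int_{\mathbb{S}^{q-1}}\Big[4\,\mathbb{P}\big(\alpha^\top(X_1-X_2)<0,\ \beta^\top(Y_1-Y_2)<0\big)-1\Big]^2d\lambda(\alpha)\,d\lambda(\beta)$$ $$=\mathbb{E}\Big[\Big(2-\frac2\pi\mathsf{Ang}(X_1-X_2,X_3-X_4)\Big)\cdot\Big(2-\frac2\pi\mathsf{Ang}(Y_1-Y_2,Y_3-Y_4)\Big)\Big]-1 .$$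
   Context: $\lambda$ denotes the uniform probability measure on the relevant unit sphere ($\mathbb{S}^{p-1}\subset\mathbb{R}^p$ or $\mathbb{S}^{q-1}\subset\mathbb{R}^q$); for nonzero vectors $U_1,U_2$ of the same dimension, $\mathsf{Ang}(U_1,U_2)=\arccos\{U_1^\top U_2/(\|U_1\|\|U_2\|)\}$. The left side is the projection-averaging extension of Kendall's $\tau=4\mathbb{P}(X_1<X_2,Y_1<Y_2)-1$. *)

theory Defs
  imports "HOL-Probability.Probability"
begin

text \<open>
  The uniform probability measure on the unit sphere, as the normalised cone measure: the law of
  the direction of a uniformly distributed point of the unit ball. Since \<open>sgn 0 = 0\<close> is
  not on the sphere, the push-forward is taken in the ambient space (where the origin is null) and
  then restricted. The lemmas below show that this is a Borel probability measure on the sphere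
  which is invariant under orthogonal transformations (the latter for well-ordered index types, as
  in the library's orthogonal invariance of Lebesgue measure).
\<close>

definition sphere_uniform :: "'a::euclidean_space measure" where
  "sphere_uniform =
     restrict_space (distr (uniform_measure lborel (ball 0 1)) borel sgn) (sphere 0 1)"

text \<open>Meant for nonzero vectors; if one of the vectors is 0, the value is \<open>arccos 0\<close>.\<close>

definition Ang :: "'a::real_inner \<Rightarrow> 'a \<Rightarrow> real" where
  "Ang u v = arccos (u \<bullet> v / (norm u * norm v))"

lemma space_sphere_uniform: "space (sphere_uniform :: 'a::euclidean_space measure) = sphere 0 1"
  by (simp add: sphere_uniform_def space_restrict_space)

lemma sets_sphere_uniform:
  "sets (sphere_uniform :: 'a::euclidean_space measure) = sets (restrict_space borel (sphere 0 1))"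
  by (simp add: sphere_uniform_def sets_restrict_space)

lemma borel_measurable_sgn_euclidean [measurable]:
  "(sgn :: 'a::euclidean_space \<Rightarrow> 'a) \<in> borel_measurable borel"
  unfolding sgn_div_norm[abs_def] by measurable

lemma sphere_uniform_ball:
  "emeasure lborel (ball (0::'a::euclidean_space) 1) \<noteq> 0"
  "emeasure lborel (ball (0::'a::euclidean_space) 1) \<noteq> \<infinity>"
proof -
  show "emeasure lborel (ball (0::'a) 1) \<noteq> \<infinity>"
    using emeasure_lborel_ball_finite[of "0::'a" 1] by simp
  show "emeasure lborel (ball (0::'a) 1) \<noteq> 0"
    using content_ball_pos[of 1 "0::'a"] by (auto simp: measure_def)
qed

lemma emeasure_sphere_uniform:
  fixes A :: "'a::euclidean_space set"
  assumes "A \<in> sets borel" "A \<subseteq> sphere 0 1"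
  shows "emeasure sphere_uniform A =
    emeasure lborel (ball 0 1 \<inter> sgn -` A) / emeasure lborel (ball (0::'a) 1)"
proof -
  have [measurable]: "A \<in> sets borel" by fact
  have s: "sgn -` A \<in> sets borel"
    using measurable_sets[OF borel_measurable_sgn_euclidean \<open>A \<in> sets borel\<close>] by simp
  show ?thesis
    using assms s unfolding sphere_uniform_def
    by (subst emeasure_restrict_space) (auto simp: emeasure_distr)
qed

lemma prob_space_sphere_uniform: "prob_space (sphere_uniform :: 'a::euclidean_space measure)"
proof
  have eq: "ball 0 1 \<inter> sgn -` sphere 0 1 = ball (0::'a) 1 - {0}"
    by (auto simp: norm_sgn)
  have "emeasure lborel (ball (0::'a) 1 - {0}) = emeasure lborel (ball (0::'a) 1)"
    by (rule emeasure_Diff_null_set) auto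
  then show "emeasure sphere_uniform (space (sphere_uniform :: 'a measure)) = 1"
    unfolding space_sphere_uniform
    by (subst emeasure_sphere_uniform)
       (use sphere_uniform_ball[where 'a='a] in \<open>auto simp: eq ennreal_divide_self top.not_eq_extremum\<close>)
qed

lemma sphere_uniform_orthogonal:
  fixes f :: "real^'n::{finite,wellorder} \<Rightarrow> real^'n::_"
  assumes f: "orthogonal_transformation f"
  shows "distr sphere_uniform sphere_uniform f = sphere_uniform"
proof (rule measure_eqI)
  have lin: "linear f" using f by (rule orthogonal_transformation_linear)
  have nrm: "norm (f x) = norm x" for x using f by (simp add: orthogonal_transformation)
  have [measurable]: "f \<in> borel_measurable borel"
    using lin by (intro borel_measurable_continuous_onI linear_continuous_on)
      (simp add: linear_conv_bounded_linear)
  have bij: "bij f" using f by (rule orthogonal_transformation_bij)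
  have fsgn: "sgn (f x) = f (sgn x)" for x
    using lin by (simp add: sgn_div_norm nrm linear_cmul)
  have meas: "f \<in> measurable sphere_uniform sphere_uniform"
    unfolding measurable_cong_sets[OF sets_sphere_uniform sets_sphere_uniform]
    by (rule measurable_restrict_space3) (auto simp: nrm)
  fix A assume "A \<in> sets (distr sphere_uniform sphere_uniform f)"
  then have A: "A \<in> sets borel" "A \<subseteq> sphere 0 1"
    by (auto simp: sets_sphere_uniform sets_restrict_space)
  have A': "f -` A \<in> sets borel" using measurable_sets[OF \<open>f \<in> borel_measurable borel\<close> A(1)] by simp
  have sub: "f -` A \<subseteq> sphere 0 1" using A(2) by (auto simp: nrm)
  define S where "S = ball 0 1 \<inter> sgn -` (f -` A)"
  have img: "f ` S = ball 0 1 \<inter> sgn -` A"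
  proof (intro equalityI subsetI)
    fix y assume y: "y \<in> ball 0 1 \<inter> sgn -` A"
    obtain x where x: "y = f x" using bij by (metis bij_pointE)
    with y have "x \<in> S" by (auto simp: S_def nrm fsgn)
    with x show "y \<in> f ` S" by auto
  qed (auto simp: S_def nrm fsgn)
  have Sb: "S \<in> sets borel" unfolding S_def
    using measurable_sets[OF borel_measurable_sgn_euclidean A'] by simp
  have Tb: "f ` S \<in> sets borel" unfolding img
    using measurable_sets[OF borel_measurable_sgn_euclidean A(1)] by simp
  have fin: "emeasure lborel B \<noteq> \<infinity>" if "B \<subseteq> ball 0 1" for B :: "(real^'n::_) set"
    using emeasure_mono[OF that, of lborel] emeasure_lborel_ball_finite[of "0::real^'n::_" 1]
    by (auto simp: top_unique)
  have subs: "S \<subseteq> ball 0 1" "f ` S \<subseteq> ball 0 1" unfolding img by (auto simp: S_def)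
  have "S \<in> lmeasurable"
    using Sb fin[OF subs(1)]
    by (intro fmeasurableI) (auto simp: top.not_eq_extremum)
  then have "measure lebesgue (f ` S) = measure lebesgue S"
    by (rule measure_orthogonal_image[OF f])
  then have "emeasure lborel (f ` S) = emeasure lborel S"
    using Sb Tb fin[OF subs(1)] fin[OF subs(2)]
    by (simp add: emeasure_eq_ennreal_measure top.not_eq_extremum measure_completion)
  then have "emeasure sphere_uniform (f -` A) = emeasure sphere_uniform A"
    using A A' sub by (simp add: emeasure_sphere_uniform flip: img S_def)
  moreover have "f -` A \<inter> sphere 0 1 = f -` A" using sub by auto
  ultimately show "emeasure (distr sphere_uniform sphere_uniform f) A = emeasure sphere_uniform A"
    using A meas by (subst emeasure_distr)
      (auto simp: space_sphere_uniform sets_sphere_uniform sets_restrict_space)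
qed simp

end

theory Submission
  imports Defs
begin

text \<open>
  Write the square of \<open>4 * P - 1\<close> as a product of expectations over the independent copies
  \<open>(X 1 - X 2, Y 1 - Y 2)\<close> and \<open>(X 3 - X 4, Y 3 - Y 4)\<close>, and exchange the order of integration.
  For fixed nonzero differences the inner integral over the two spheres factorises into measures
  of half-spaces, equal to \<open>1 / 2\<close>, and of intersections of two half-spaces, equal to
  \<open>1 / 2 - Ang u v / (2 * pi)\<close>. The continuity assumption enters only to exclude that
  a difference vanishes with positive probability: a single direction in which the projected law
  has no atoms suffices.
\<close>

section \<open>Orthogonal invariance of Lebesgue measure and of the uniform measure on the
  sphere\<close>

lemma nn_integral_lborel_plus:
  fixes g :: "'a::euclidean_space \<Rightarrow> ennreal"
  assumes [measurable]: "g \<in> borel_measurable borel"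
  shows "(\<integral>\<^sup>+x. g (c + x) \<partial>lborel) = (\<integral>\<^sup>+x. g x \<partial>lborel)"
  by (subst (2) lborel_distr_plus[of c, symmetric]) (simp add: nn_integral_distr)

lemma borel_measurable_orthogonal_transformation:
  fixes f :: "'a::euclidean_space \<Rightarrow> 'a"
  assumes "orthogonal_transformation f"
  shows "f \<in> borel_measurable borel"
  using orthogonal_transformation_linear[OF assms]
  by (intro borel_measurable_continuous_onI linear_continuous_on)
    (simp add: linear_conv_bounded_linear)

text \<open>
  The image measure is translation invariant, hence a multiple of Lebesgue measure; the unit ball,
  which is preserved, fixes the factor. The proof runs the usual uniqueness argument for Haar
  measures, testing against the unit ball.
\<close>

lemma distr_lborel_orthogonal:
  fixes f :: "'a::euclidean_space \<Rightarrow> 'a"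
  assumes f: "orthogonal_transformation f"
  shows "distr lborel borel f = lborel"
proof (rule measure_eqI)
  have lin: "linear f" using f by (rule orthogonal_transformation_linear)
  have nrm: "norm (f x) = norm x" for x using f by (simp add: orthogonal_transformation)
  have [measurable]: "f \<in> borel_measurable borel"
    by (rule borel_measurable_orthogonal_transformation[OF f])
  let ?b = "ball (0::'a) 1"
  have [measurable]: "?b \<in> sets borel" by simp
  fix B :: "'a set" assume "B \<in> sets (distr lborel borel f)"
  then have [measurable]: "B \<in> sets borel" by simp
  \<comment> \<open>Both measures of \<open>B\<close> are compared after multiplication by the
    volume of the unit ball. That volume is written as an integral over y of the indicator of the
    ball shifted to the centre \<open>f x\<close>, which makes a double integral available for
    Fubini.\<close>
  have "emeasure (distr lborel borel f) B * emeasure lborel ?b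
      = (\<integral>\<^sup>+x. indicator B (f x) * emeasure lborel ?b \<partial>lborel)"
    by (simp add: nn_integral_multc nn_integral_distr flip: nn_integral_indicator)
  also have "\<dots> = (\<integral>\<^sup>+x. \<integral>\<^sup>+y. indicator B (f x) * indicator ?b (- f x + y) \<partial>lborel \<partial>lborel)"
  proof (rule nn_integral_cong)
    fix x :: 'a
    have "(\<integral>\<^sup>+y. indicator B (f x) * indicator ?b (- f x + y) \<partial>lborel)
        = (\<integral>\<^sup>+y. indicator B (f x) * indicator ?b y \<partial>lborel)"
      by (rule nn_integral_lborel_plus) measurable
    then show "indicator B (f x) * emeasure lborel ?b
        = (\<integral>\<^sup>+y. indicator B (f x) * indicator ?b (- f x + y) \<partial>lborel)"
      by (simp add: nn_integral_cmult)
  qed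
  also have "\<dots> = (\<integral>\<^sup>+y. \<integral>\<^sup>+x. indicator B (f x) * indicator ?b (- f x + y) \<partial>lborel \<partial>lborel)"
    by (rule lborel_pair.Fubini') measurable
  \<comment> \<open>With y = \<open>f z\<close>, substituting \<open>z + x\<close> for x turns
    \<open>f x\<close> into \<open>f x + y\<close> and \<open>- f x + y\<close> into
    \<open>- f x\<close>; the minus sign disappears because the ball is symmetric.\<close>
  also have "\<dots> = (\<integral>\<^sup>+y. \<integral>\<^sup>+x. indicator B (f x + y) * indicator ?b (f x) \<partial>lborel \<partial>lborel)"
  proof (rule nn_integral_cong)
    fix y :: 'a
    obtain z where y: "y = f z"
      using orthogonal_transformation_surj[OF f] by (meson surjD)
    have "(\<integral>\<^sup>+x. indicator B (f x) * indicator ?b (- f x + y) \<partial>lborel)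
        = (\<integral>\<^sup>+x. indicator B (f (z + x)) * indicator ?b (- f (z + x) + y) \<partial>lborel)"
      by (rule nn_integral_lborel_plus[symmetric]) measurable
    also have "\<dots> = (\<integral>\<^sup>+x. indicator B (f x + y) * indicator ?b (f x) \<partial>lborel)"
      by (intro nn_integral_cong) (auto simp: y linear_add[OF lin] add.commute indicator_def)
    finally show "(\<integral>\<^sup>+x. indicator B (f x) * indicator ?b (- f x + y) \<partial>lborel) = \<dots>" .
  qed
  also have "\<dots> = (\<integral>\<^sup>+x. \<integral>\<^sup>+y. indicator B (f x + y) * indicator ?b (f x) \<partial>lborel \<partial>lborel)"
    by (rule lborel_pair.Fubini') measurable
  \<comment> \<open>Now y is shifted back by \<open>f x\<close>, which leaves the measure of
    \<open>B\<close>; \<open>f x\<close> lies in the ball exactly when x does, because f preserves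
    norms.\<close>
  also have "\<dots> = (\<integral>\<^sup>+x. emeasure lborel B * indicator ?b x \<partial>lborel)"
  proof (rule nn_integral_cong)
    fix x :: 'a
    have "(\<integral>\<^sup>+y. indicator B (f x + y) * indicator ?b (f x) \<partial>lborel)
        = (\<integral>\<^sup>+y. indicator B y * indicator ?b (f x) \<partial>lborel)"
      by (rule nn_integral_lborel_plus) measurable
    also have "\<dots> = emeasure lborel B * indicator ?b x"
      by (subst nn_integral_multc) (auto simp: indicator_def[of ?b] nrm)
    finally show "(\<integral>\<^sup>+y. indicator B (f x + y) * indicator ?b (f x) \<partial>lborel) = \<dots>" .
  qed
  also have "\<dots> = emeasure lborel B * emeasure lborel ?b"
    by (simp add: nn_integral_cmult)
  \<comment> \<open>The volume of the ball is neither 0 nor infinite, so it cancels.\<close>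
  finally show "emeasure (distr lborel borel f) B = emeasure lborel B"
    using sphere_uniform_ball[where 'a='a]
    by (auto simp: mult.commute[of _ "emeasure lborel ?b"] ennreal_mult_cancel_left)
qed simp

text \<open>An orthogonal map commutes with \<open>sgn\<close> and preserves the unit ball. Hence
  the cone over the preimage of A is the preimage of the cone over A, and the invariance of Lebesgue
  measure carries over. In contrast to \<open>sphere_uniform_orthogonal\<close>, this covers every
  Euclidean space, in particular vectors over arbitrary finite index types.\<close>

lemma distr_sphere_uniform_orthogonal:
  fixes f :: "'a::euclidean_space \<Rightarrow> 'a"
  assumes f: "orthogonal_transformation f"
  shows "distr sphere_uniform sphere_uniform f = sphere_uniform"
proof (rule measure_eqI)
  have lin: "linear f" using f by (rule orthogonal_transformation_linear)
  have nrm: "norm (f x) = norm x" for x using f by (simp add: orthogonal_transformation)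
  have [measurable]: "f \<in> borel_measurable borel"
    by (rule borel_measurable_orthogonal_transformation[OF f])
  have fsgn: "sgn (f x) = f (sgn x)" for x
    using lin by (simp add: sgn_div_norm nrm linear_cmul)
  have meas: "f \<in> measurable sphere_uniform sphere_uniform"
    unfolding measurable_cong_sets[OF sets_sphere_uniform sets_sphere_uniform]
    by (rule measurable_restrict_space3) (auto simp: nrm)
  fix A assume "A \<in> sets (distr sphere_uniform sphere_uniform f)"
  then have A[measurable]: "A \<in> sets borel" and A1: "A \<subseteq> sphere 0 1"
    by (auto simp: sets_sphere_uniform sets_restrict_space)
  have A': "f -` A \<in> sets borel" using measurable_sets[OF \<open>f \<in> borel_measurable borel\<close> A] by simp
  have sub: "f -` A \<subseteq> sphere 0 1" using A1 by (auto simp: nrm)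
  have "ball 0 1 \<inter> sgn -` f -` A = f -` (ball 0 1 \<inter> sgn -` A)"
    by (auto simp: nrm fsgn)
  moreover have "ball 0 1 \<inter> sgn -` A \<in> sets borel"
    using measurable_sets[OF borel_measurable_sgn_euclidean A] by simp
  then have "emeasure lborel (f -` (ball 0 1 \<inter> sgn -` A)) = emeasure lborel (ball 0 1 \<inter> sgn -` A)"
    by (subst (2) distr_lborel_orthogonal[OF f, symmetric]) (simp add: emeasure_distr)
  ultimately have "emeasure sphere_uniform (f -` A) = emeasure sphere_uniform A"
    using A A1 A' sub by (simp add: emeasure_sphere_uniform)
  moreover have "f -` A \<inter> sphere 0 1 = f -` A" using sub by auto
  ultimately show "emeasure (distr sphere_uniform sphere_uniform f) A = emeasure sphere_uniform A"
    using A A1 meas by (subst emeasure_distr)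
      (auto simp: space_sphere_uniform sets_sphere_uniform sets_restrict_space)
qed simp

section \<open>Null great subspheres and half-spaces\<close>

lemma measurable_sphere_uniform_id [measurable]:
  "(\<lambda>x. x) \<in> measurable sphere_uniform borel"
  unfolding measurable_cong_sets[OF sets_sphere_uniform refl]
  by (rule measurable_restrict_space1) simp

text \<open>The cone over the great subsphere orthogonal to w lies in a hyperplane, which is a
  Lebesgue null set.\<close>

lemma AE_sphere_uniform_inner_nonzero:
  fixes w :: "'a::euclidean_space"
  assumes "w \<noteq> 0"
  shows "AE x in sphere_uniform. x \<bullet> w \<noteq> 0"
proof -
  let ?A = "{x\<in>sphere 0 1. x \<bullet> w = 0}"
  have [measurable]: "?A \<in> sets borel" by measurable
  have "{x. w \<bullet> x = 0} \<in> null_sets lebesgue"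
    using negligible_hyperplane[of w 0] assms by (simp add: negligible_iff_null_sets)
  moreover have "{x. w \<bullet> x = 0} \<in> sets borel" by measurable
  ultimately have "{x. w \<bullet> x = 0} \<in> null_sets lborel"
    by (auto simp: null_sets_def)
  moreover have "ball 0 1 \<inter> sgn -` ?A \<in> sets borel"
    using measurable_sets[OF borel_measurable_sgn_euclidean \<open>?A \<in> sets borel\<close>] by simp
  moreover have "ball 0 1 \<inter> sgn -` ?A \<subseteq> {x. w \<bullet> x = 0}"
    by (auto simp: sgn_div_norm inner_commute)
  ultimately have "emeasure lborel (ball 0 1 \<inter> sgn -` ?A) = 0"
    by (metis null_setsD1 null_sets_subset sets_lborel)
  moreover have "emeasure sphere_uniform ?A = emeasure lborel (ball 0 1 \<inter> sgn -` ?A) / emeasure lborel (ball (0::'a) 1)"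
    by (rule emeasure_sphere_uniform) (fact, blast)
  ultimately have "emeasure sphere_uniform ?A = 0"
    by simp
  moreover have "?A \<in> sets sphere_uniform"
    using \<open>?A \<in> sets borel\<close> by (auto simp: sets_sphere_uniform sets_restrict_space)
  ultimately have "?A \<in> null_sets sphere_uniform"
    by (rule null_setsI)
  then show ?thesis
    by (rule AE_I') (auto simp: space_sphere_uniform)
qed

lemma measure_sphere_uniform_orthogonal:
  fixes f :: "'a::euclidean_space \<Rightarrow> 'a"
  assumes f: "orthogonal_transformation f" and P [measurable]: "Measurable.pred borel P"
  shows "measure sphere_uniform {x \<in> space sphere_uniform. P (f x)} = measure sphere_uniform {x \<in> space sphere_uniform. P x}"
proof -
  have nrm: "norm (f x) = norm x" for x using f by (simp add: orthogonal_transformation)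
  have [measurable]: "f \<in> borel_measurable borel"
    by (rule borel_measurable_orthogonal_transformation[OF f])
  have meas: "f \<in> measurable sphere_uniform sphere_uniform"
    unfolding measurable_cong_sets[OF sets_sphere_uniform sets_sphere_uniform]
    by (rule measurable_restrict_space3) (auto simp: nrm)
  let ?A = "{x \<in> space sphere_uniform. P x}"
  have "?A \<in> sets sphere_uniform" by measurable
  then have "measure (distr sphere_uniform sphere_uniform f) ?A
      = measure sphere_uniform (f -` ?A \<inter> space sphere_uniform)"
    by (rule measure_distr[OF meas])
  moreover have "f -` ?A \<inter> space sphere_uniform = {x \<in> space sphere_uniform. P (f x)}"
    by (auto simp: space_sphere_uniform nrm)
  ultimately show ?thesis
    by (simp add: distr_sphere_uniform_orthogonal[OF f])
qed

text \<open>The antipodal map preserves the measure and sends the half-space to its opposite, which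
  is its complement up to a null great subsphere.\<close>

lemma measure_sphere_uniform_halfspace:
  fixes w :: "'a::euclidean_space"
  assumes "w \<noteq> 0"
  shows "measure sphere_uniform {x \<in> space sphere_uniform. x \<bullet> w < 0} = 1 / 2"
proof -
  interpret prob_space "sphere_uniform :: 'a measure" by (rule prob_space_sphere_uniform)
  have "orthogonal_transformation (uminus :: 'a \<Rightarrow> 'a)"
    by (simp add: orthogonal_transformation linear_iff)
  then have "prob {x \<in> space sphere_uniform. (- x) \<bullet> w < 0} = prob {x \<in> space sphere_uniform. x \<bullet> w < 0}"
    by (rule measure_sphere_uniform_orthogonal) measurable
  moreover have "prob {x \<in> space sphere_uniform. (- x) \<bullet> w < 0} = prob (space sphere_uniform - {x \<in> space sphere_uniform. x \<bullet> w < 0})"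
    using AE_sphere_uniform_inner_nonzero[OF assms]
    by (intro measure_eq_AE) auto
  moreover have "\<dots> = 1 - prob {x \<in> space sphere_uniform. x \<bullet> w < 0}"
    by (rule prob_compl) measurable
  ultimately show ?thesis by simp
qed

section \<open>Wedges and intersections of two half-spaces\<close>

lemma additive_nonneg_imp_linear:
  fixes D :: "real \<Rightarrow> real"
  assumes T: "0 < T" and nonneg: "\<And>t. 0 \<le> t \<Longrightarrow> t \<le> T \<Longrightarrow> 0 \<le> D t"
    and add: "\<And>s t. 0 \<le> s \<Longrightarrow> 0 \<le> t \<Longrightarrow> s + t \<le> T \<Longrightarrow> D (s + t) = D s + D t"
    and t: "0 \<le> t" "t \<le> T"
  shows "D t = t / T * D T"
proof -
  have D0: "D 0 = 0" using add[of 0 0] T by simp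
  \<comment> \<open>Nonnegativity makes this solution of Cauchy's equation monotone, which takes the
    place of continuity.\<close>
  have mono: "D s \<le> D r" if "0 \<le> s" "s \<le> r" "r \<le> T" for s r
    using add[of s "r - s"] nonneg[of "r - s"] that by simp
  have mult: "D (real k * s) = real k * D s" if "0 \<le> s" "real k * s \<le> T" for k s
    using that
  proof (induction k)
    case (Suc k)
    then show ?case using add[of "real k * s" s] by (simp add: algebra_simps)
  qed (simp add: D0)
  \<comment> \<open>With s = T / n and k the integer part of t / s, both \<open>D t\<close> and its
    linear candidate lie between k and k + 1 times \<open>D s\<close>, and \<open>D s\<close> is
    \<open>D T / n\<close>. The case t = T is separate because there (k + 1) * s would exceed T,
    where nothing is known about D.\<close>
  have bound: "\<bar>D t - t / T * D T\<bar> \<le> D T / real n" if n: "n > 0" for n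
  proof (cases "t = T")
    case True
    then show ?thesis using T nonneg[of T] by simp
  next
    case False
    define s where "s = T / n"
    have s: "s > 0" "real n * s = T" using T n by (auto simp: s_def)
    have Ds: "D s = D T / n" using mult[of s n] s n by (simp add: field_simps)
    define k where "k = nat \<lfloor>t / s\<rfloor>"
    have "0 \<le> t / s" using s t by simp
    then have k: "real k \<le> t / s" "t / s < real k + 1"
      unfolding k_def by linarith+
    have "t / s < real n" using t s False by (simp add: divide_less_eq)
    then have "Suc k \<le> n" using k by linarith
    then have "real (Suc k) * s \<le> real n * s" using s by (intro mult_right_mono) auto
    then have kT: "real (Suc k) * s \<le> T" using s by simp
    have kt: "real k * s \<le> t" "t \<le> real (Suc k) * s" using k s by (auto simp: field_simps)
    have "D (real k * s) \<le> D t" "D t \<le> D (real (Suc k) * s)"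
      using kt kT s t by - (rule mono; simp)+
    moreover have "D (real k * s) = real k * D s" "D (real (Suc k) * s) = real (Suc k) * D s"
      using kT kt(1) s(1) t(2) by (intro mult; linarith)+
    ultimately have 1: "real k * D s \<le> D t" "D t \<le> (real k + 1) * D s" by (auto simp: add.commute)
    have "t / T * D T = t / s * D s" using s n Ds T by (simp add: s_def)
    moreover have "D s \<ge> 0" using Ds nonneg[of T] T by simp
    then have "real k * D s \<le> t / s * D s" "t / s * D s \<le> (real k + 1) * D s"
      using k by (intro mult_right_mono; simp)+
    moreover have "(real k + 1) * D s = real k * D s + D s" by (simp add: algebra_simps)
    ultimately show ?thesis using 1 Ds unfolding abs_le_iff by linarith
  qed
  have "(\<lambda>n. D T / real n) \<longlonglongrightarrow> 0" by (rule lim_const_over_n)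
  then have "\<bar>D t - t / T * D T\<bar> \<le> 0"
    by (rule tendsto_lowerbound) (use bound in \<open>auto intro!: eventually_sequentiallyI[of 1]\<close>)
  then show ?thesis by simp
qed

text \<open>For orthonormal e1 and e2 this is the rotation by t in their plane, the identity on the
  orthogonal complement. Writing it as x plus a correction inside the plane avoids completing e1, e2
  to a basis.\<close>

definition plane_rotation :: "'a::real_inner \<Rightarrow> 'a \<Rightarrow> real \<Rightarrow> 'a \<Rightarrow> 'a" where
  "plane_rotation e1 e2 t x = x + ((x \<bullet> e1) * (cos t - 1) - (x \<bullet> e2) * sin t) *\<^sub>R e1
     + ((x \<bullet> e1) * sin t + (x \<bullet> e2) * (cos t - 1)) *\<^sub>R e2"

lemma plane_rotation_inner:
  assumes "e1 \<bullet> e1 = 1" "e2 \<bullet> e2 = 1" "e1 \<bullet> e2 = 0"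
  shows "plane_rotation e1 e2 t x \<bullet> e1 = (x \<bullet> e1) * cos t - (x \<bullet> e2) * sin t"
    and "plane_rotation e1 e2 t x \<bullet> e2 = (x \<bullet> e1) * sin t + (x \<bullet> e2) * cos t"
  using assms by (simp_all add: plane_rotation_def inner_simps inner_commute[of e2 e1] algebra_simps)

lemma orthogonal_transformation_plane_rotation:
  fixes e1 e2 :: "'a::euclidean_space"
  assumes e: "e1 \<bullet> e1 = 1" "e2 \<bullet> e2 = 1" "e1 \<bullet> e2 = 0"
  shows "orthogonal_transformation (plane_rotation e1 e2 t)"
  unfolding orthogonal_transformation_def
proof safe
  show "linear (plane_rotation e1 e2 t)"
    by (rule linearI) (simp_all add: plane_rotation_def inner_simps algebra_simps)
  fix v w
  define a b c d where "a = v \<bullet> e1" "b = v \<bullet> e2" "c = w \<bullet> e1" "d = w \<bullet> e2"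
  have "plane_rotation e1 e2 t v \<bullet> plane_rotation e1 e2 t w
      = plane_rotation e1 e2 t v \<bullet> w + (c * (cos t - 1) - d * sin t) * (plane_rotation e1 e2 t v \<bullet> e1)
        + (c * sin t + d * (cos t - 1)) * (plane_rotation e1 e2 t v \<bullet> e2)"
    by (subst (2) plane_rotation_def) (simp add: inner_simps a_b_c_d_def)
  also have "\<dots> = v \<bullet> w + (a * (cos t - 1) - b * sin t) * c + (a * sin t + b * (cos t - 1)) * d
        + (c * (cos t - 1) - d * sin t) * (a * cos t - b * sin t)
        + (c * sin t + d * (cos t - 1)) * (a * sin t + b * cos t)"
    unfolding plane_rotation_inner[OF e]
    by (simp add: plane_rotation_def inner_simps a_b_c_d_def inner_commute[of e1 w] inner_commute[of e2 w])
  \<comment> \<open>The mixed terms in a * d and b * c cancel, and the factor that remains vanishes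
    by Pythagoras.\<close>
  also have "\<dots> = v \<bullet> w + (a * c + b * d) * ((sin t)\<^sup>2 + (cos t)\<^sup>2 - 1)"
    by (simp only: power2_eq_square) (simp only: algebra_simps)
  finally show "plane_rotation e1 e2 t v \<bullet> plane_rotation e1 e2 t w = v \<bullet> w"
    by simp
qed

text \<open>
  By invariance under rotations of the plane spanned by \<open>e1\<close> and \<open>e2\<close>, the measure of
  the wedge is an additive function of the angle \<open>t\<close>; its value at \<open>pi\<close> is that of a
  half-space.
\<close>

lemma measure_sphere_uniform_wedge:
  fixes e1 e2 :: "'a::euclidean_space"
  assumes e: "e1 \<bullet> e1 = 1" "e2 \<bullet> e2 = 1" "e1 \<bullet> e2 = 0" and t: "0 \<le> t" "t \<le> pi"
  shows "measure sphere_uniform {x \<in> space sphere_uniform. x \<bullet> e1 < 0 \<and> 0 \<le> x \<bullet> (cos t *\<^sub>R e1 + sin t *\<^sub>R e2)} = t / (2 * pi)"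
proof -
  interpret prob_space "sphere_uniform :: 'a measure" by (rule prob_space_sphere_uniform)
  define v where "v t = cos t *\<^sub>R e1 + sin t *\<^sub>R e2" for t
  define D where "D t = prob {x \<in> space sphere_uniform. x \<bullet> v 0 < 0 \<and> 0 \<le> x \<bullet> v t}" for t
  have e1: "e1 \<noteq> 0" using e by auto
  have v0: "v 0 = e1" by (simp add: v_def)
  \<comment> \<open>Rotation by a carries the pair of vectors at angles 0 and b to the pair at
    angles a and a + b, so the measure of a wedge depends only on its opening angle.\<close>
  have rot: "D b = prob {x \<in> space sphere_uniform. x \<bullet> v a < 0 \<and> 0 \<le> x \<bullet> v (a + b)}" for a b
  proof -
    have "plane_rotation e1 e2 a x \<bullet> v (a + s) = x \<bullet> v s" for x s
    proof -
      \<comment> \<open>Writing s as \<open>a + s - a\<close> lets the difference formulas produce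
        the products of sines and cosines that occur on the left.\<close>
      have "plane_rotation e1 e2 a x \<bullet> v (a + s)
         = (x \<bullet> e1) * cos (a + s - a) + (x \<bullet> e2) * sin (a + s - a)"
        unfolding cos_diff sin_diff
        by (simp add: v_def inner_simps plane_rotation_inner[OF e] algebra_simps)
      then show ?thesis by (simp add: v_def inner_simps algebra_simps)
    qed
    from this[of _ 0] this[of _ b] show ?thesis
      using measure_sphere_uniform_orthogonal[OF orthogonal_transformation_plane_rotation[OF e, of a],
          of "\<lambda>x. x \<bullet> v a < 0 \<and> 0 \<le> x \<bullet> v (a + b)"]
      by (simp add: D_def)
  qed
  have add: "D (a + b) = D a + D b" if ab: "0 \<le> a" "0 \<le> b" "a + b \<le> pi" for a b
  proof -
    \<comment> \<open>the linear relation between three coplanar unit vectors\<close>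
    have three: "sin (a + b) * (x \<bullet> v a) = sin b * (x \<bullet> v 0) + sin a * (x \<bullet> v (a + b))" for x
    proof -
      have "sin (a + b) * (x \<bullet> v a) - sin b * (x \<bullet> v 0) - sin a * (x \<bullet> v (a + b))
          = (x \<bullet> e1) * sin b * ((sin a)\<^sup>2 + (cos a)\<^sup>2 - 1)"
        by (simp only: v_def inner_simps sin_add cos_add power2_eq_square sin_zero cos_zero)
          (simp only: algebra_simps mult_zero_left mult_1_left)
      then show ?thesis by simp
    qed
    have sgn: "sin a \<ge> 0" "sin b \<ge> 0" "sin (a + b) \<ge> 0"
      using ab by (auto intro!: sin_ge_zero)
    let ?A = "{x \<in> space sphere_uniform. x \<bullet> v 0 < 0 \<and> 0 \<le> x \<bullet> v a}"
    let ?B = "{x \<in> space sphere_uniform. x \<bullet> v a < 0 \<and> 0 \<le> x \<bullet> v (a + b)}"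
    let ?C = "{x \<in> space sphere_uniform. x \<bullet> v 0 < 0 \<and> 0 \<le> x \<bullet> v (a + b)}"
    \<comment> \<open>The relation \<open>three\<close> determines signs only when
      \<open>sin a\<close> and \<open>sin (a + b)\<close> are positive. For a = 0 the wedge
      \<open>?A\<close> is empty. For a + b = pi the outer vectors are opposite, and the
      decomposition holds only up to the null set orthogonal to e1.\<close>
    consider "a = 0" | "a + b = pi" | "sin a > 0" "sin (a + b) > 0"
      using ab sin_gt_zero[of a] sin_gt_zero[of "a + b"] by fastforce
    then have "prob ?C = prob (?A \<union> ?B)"
    proof cases
      case 1
      then have "?C = ?A \<union> ?B" by auto
      then show ?thesis by (rule arg_cong)
    next
      case 2
      then have "v (a + b) = - v 0" by (simp add: v_def)
      then show ?thesis using AE_sphere_uniform_inner_nonzero[OF e1]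
        by (intro measure_eq_AE) (auto simp: v0)
    next
      case 3
      have "0 \<le> x \<bullet> v (a + b)" if "x \<in> ?A" for x
      proof -
        have "0 \<le> sin (a + b) * (x \<bullet> v a)" "sin b * (x \<bullet> v 0) \<le> 0"
          using that sgn by (auto intro!: mult_nonneg_nonneg mult_nonneg_nonpos)
        with three[of x] have "0 \<le> sin a * (x \<bullet> v (a + b))" by linarith
        with 3 show ?thesis by (simp add: zero_le_mult_iff)
      qed
      moreover have "x \<bullet> v 0 < 0" if "x \<in> ?B" for x
      proof -
        have "sin (a + b) * (x \<bullet> v a) < 0" "0 \<le> sin a * (x \<bullet> v (a + b))"
          using that 3 by (auto intro!: mult_nonneg_nonneg mult_pos_neg)
        with three[of x] have "sin b * (x \<bullet> v 0) < 0" by linarith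
        with sgn show ?thesis by (auto simp: mult_less_0_iff)
      qed
      ultimately have "?C = ?A \<union> ?B" by fastforce
      then show ?thesis by (rule arg_cong)
    qed
    also have "\<dots> = prob ?A + prob ?B"
      by (rule finite_measure_Union) auto
    finally show ?thesis using rot[of b a] by (simp add: D_def)
  qed
  \<comment> \<open>At pi the second vector is \<open>- e1\<close>, so its condition follows from
    the first.\<close>
  have "D pi = prob {x \<in> space sphere_uniform. x \<bullet> e1 < 0}"
    by (auto simp: D_def v_def intro!: arg_cong[where f=prob])
  also have "\<dots> = 1 / 2" by (rule measure_sphere_uniform_halfspace[OF e1])
  finally have "D pi = 1 / 2" .
  moreover have "D t = t / pi * D pi"
    by (rule additive_nonneg_imp_linear[OF pi_gt_zero _ add t]) (simp_all add: D_def)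
  ultimately have "D t = t / pi * (1 / 2)" by (simp only:)
  then show ?thesis by (simp add: D_def v_def)
qed

lemma abs_cosine_le_1: "\<bar>u \<bullet> w / (norm u * norm w)\<bar> \<le> (1::real)"
proof (cases "norm u * norm w = 0")
  case False
  then have "norm u * norm w > 0" by auto
  then show ?thesis
    using Cauchy_Schwarz_ineq2[of u w] by (simp add: abs_mult divide_le_eq)
\<comment> \<open>If a vector is zero, the quotient is 0 because division by zero yields 0.\<close>
qed auto

text \<open>The half-space of u splits into the set in question and a wedge whose opening angle is
  the angle between u and w. The orthonormal pair spanning the wedge comes from Gram-Schmidt applied
  to the directions of u and w.\<close>

lemma measure_sphere_uniform_two_halfspaces:
  fixes u w :: "'a::euclidean_space"
  assumes u: "u \<noteq> 0" and w: "w \<noteq> 0"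
  shows "measure sphere_uniform {x \<in> space sphere_uniform. x \<bullet> u < 0 \<and> x \<bullet> w < 0} = 1 / 2 - Ang u w / (2 * pi)"
proof -
  interpret prob_space "sphere_uniform :: 'a measure" by (rule prob_space_sphere_uniform)
  define t where "t = Ang u w"
  define e1 where "e1 = sgn u"
  define r where "r = sgn w - cos t *\<^sub>R e1"
  note quot = abs_cosine_le_1[of u w]
  have ct: "cos t = u \<bullet> w / (norm u * norm w)"
    unfolding t_def Ang_def using quot by (intro cos_arccos_abs)
  have t: "0 \<le> t" "t \<le> pi"
    unfolding t_def Ang_def using quot by (auto simp only: abs_le_iff intro!: arccos_lbound arccos_ubound)
  have ee: "e1 \<bullet> e1 = 1" "sgn w \<bullet> sgn w = 1"
    using u w by (simp_all add: e1_def norm_sgn dot_square_norm)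
  have ew: "e1 \<bullet> sgn w = cos t"
    by (simp add: e1_def sgn_div_norm ct divide_inverse mult_ac)
  have re: "e1 \<bullet> r = 0" using ee ew by (simp add: r_def inner_simps)
  \<comment> \<open>The remainder r has length \<open>sin t\<close> and so vanishes exactly for
    parallel vectors. These are treated separately: equal directions leave a half-space, opposite
    ones the empty set.\<close>
  have "r \<bullet> r = 1 - (cos t)\<^sup>2"
    using ee ew by (simp add: r_def inner_simps inner_commute[of "sgn w" e1] power2_eq_square algebra_simps)
  then have rr: "r \<bullet> r = (sin t)\<^sup>2" by (simp add: sin_squared_eq)
  have sgn1: "x \<bullet> u < 0 \<longleftrightarrow> x \<bullet> e1 < 0" "x \<bullet> w < 0 \<longleftrightarrow> x \<bullet> sgn w < 0" for x
    using u w by (simp_all add: e1_def sgn_div_norm mult_less_0_iff)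
  have half: "prob {x \<in> space sphere_uniform. x \<bullet> e1 < 0} = 1 / 2"
    using measure_sphere_uniform_halfspace[OF u] by (simp add: sgn1)
  let ?Q = "{x \<in> space sphere_uniform. x \<bullet> e1 < 0 \<and> x \<bullet> sgn w < 0}"
  have "prob ?Q = 1 / 2 - t / (2 * pi)"
  proof (cases "sin t = 0")
    case True
    then have "r = 0" using rr by simp
    then have sw: "sgn w = cos t *\<^sub>R e1" by (simp add: r_def)
    have "t = 0 \<or> t = pi" using True t sin_gt_zero[of t] by fastforce
    then show ?thesis
    proof
      assume "t = 0"
      then show ?thesis using half by (simp add: sw)
    next
      assume "t = pi"
      then have "?Q = {}" by (auto simp: sw)
      then show ?thesis using \<open>t = pi\<close> by (metis diff_self divide_self_if measure_empty mult.commute nonzero_divide_mult_cancel_left pi_neq_zero)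
    qed
  next
    case False
    define e2 where "e2 = (1 / sin t) *\<^sub>R r"
    have e2: "e2 \<bullet> e2 = 1" "e1 \<bullet> e2 = 0"
      using False rr re by (simp_all add: e2_def power2_eq_square)
    have sw: "sgn w = cos t *\<^sub>R e1 + sin t *\<^sub>R e2"
      using False by (simp add: e2_def r_def)
    let ?W = "{x \<in> space sphere_uniform. x \<bullet> e1 < 0 \<and> 0 \<le> x \<bullet> sgn w}"
    have "prob (?Q \<union> ?W) = prob ?Q + prob ?W"
      by (rule finite_measure_Union) auto
    moreover have "?Q \<union> ?W = {x \<in> space sphere_uniform. x \<bullet> e1 < 0}" by auto
    moreover have "prob ?W = t / (2 * pi)"
      using measure_sphere_uniform_wedge[OF ee(1) e2 t] by (simp add: sw)
    ultimately show ?thesis using half by simp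
  qed
  then show ?thesis by (simp add: sgn1 t_def)
qed

section \<open>Measurability of the angle and integrals of bounded functions\<close>

lemma borel_measurable_Ang [measurable]:
  fixes f g :: "'b \<Rightarrow> 'a::euclidean_space"
  assumes [measurable]: "f \<in> borel_measurable N" "g \<in> borel_measurable N"
  shows "(\<lambda>x. Ang (f x) (g x)) \<in> borel_measurable N"
proof -
  \<comment> \<open>Clamping the argument to [-1, 1], where \<open>arccos\<close> is continuous,
    gives a function continuous on the whole line; by Cauchy-Schwarz the clamp does not change
    \<open>Ang\<close>.\<close>
  have "continuous_on UNIV (\<lambda>s::real. arccos (max (-1) (min 1 s)))"
    by (intro continuous_intros) auto
  then have [measurable]: "(\<lambda>s::real. arccos (max (-1) (min 1 s))) \<in> borel_measurable borel"
    by (rule borel_measurable_continuous_onI)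
  have "Ang u w = arccos (max (-1) (min 1 (u \<bullet> w / (norm u * norm w))))" for u w :: 'a
    using abs_cosine_le_1[of u w] unfolding Ang_def abs_le_iff
    by (metis max.absorb2 min.absorb2 minus_le_iff)
  then show ?thesis by simp
qed

lemma Fubini_integral_bounded:
  fixes f :: "'a \<Rightarrow> 'b \<Rightarrow> real"
  assumes "finite_measure A" "finite_measure K"
    and f [measurable]: "case_prod f \<in> borel_measurable (A \<Otimes>\<^sub>M K)"
    and bnd: "\<And>a k. \<bar>f a k\<bar> \<le> C"
  shows "(\<integral>a. \<integral>k. f a k \<partial>K \<partial>A) = (\<integral>k. \<integral>a. f a k \<partial>A \<partial>K)"
proof -
  interpret A: finite_measure A by fact
  interpret K: finite_measure K by fact
  interpret pair_sigma_finite A K ..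
  interpret AK: finite_measure "A \<Otimes>\<^sub>M K"
    by (rule finite_measure_pair_measure) unfold_locales
  have "integrable (A \<Otimes>\<^sub>M K) (case_prod f)"
    by (rule AK.integrable_const_bound[where B=C]) (use bnd in auto)
  from Fubini_integral[OF this] show ?thesis ..
qed

lemma abs_integral_prob_le:
  fixes f :: "'a \<Rightarrow> real"
  assumes "prob_space A" and bnd: "\<And>a. \<bar>f a\<bar> \<le> C"
  shows "\<bar>\<integral>a. f a \<partial>A\<bar> \<le> C"
proof (cases "f \<in> borel_measurable A")
  case True
  interpret prob_space A by fact
  have "integrable A f"
    by (rule integrable_const_bound[where B=C]) (use bnd True in auto)
  then have "- C \<le> expectation f" "expectation f \<le> C"
    using bnd by (auto intro!: integral_ge_const integral_le_const simp: abs_le_iff minus_le_iff)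
  then show ?thesis by simp
next
  \<comment> \<open>A function that is not integrable has integral 0 by convention, and the bound at
    any one point shows that C is nonnegative.\<close>
  case False
  then have "(\<integral>a. f a \<partial>A) = 0"
    using borel_measurable_integrable not_integrable_integral_eq by blast
  then show ?thesis using bnd[of undefined] by linarith
qed

section \<open>Integrals of products of sign indicators over the spheres\<close>

definition neg_ind :: "'a::euclidean_space \<Rightarrow> 'a \<Rightarrow> real" where
  "neg_ind u x = (if x \<bullet> u < 0 then 1 else 0)"

text \<open>Measurability is joint in the vector and the direction, as the later exchanges of
  integrals require.\<close>

lemma borel_measurable_neg_ind [measurable (raw)]:
  assumes [measurable]: "f \<in> borel_measurable N" "g \<in> borel_measurable N"
  shows "(\<lambda>z. neg_ind (f z) (g z)) \<in> borel_measurable N"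
  unfolding neg_ind_def by measurable

lemma integrable_neg_ind_sphere_uniform [simp]:
  "integrable sphere_uniform (\<lambda>x. neg_ind u x)"
  "integrable sphere_uniform (\<lambda>x. neg_ind u x * neg_ind v x)"
proof -
  interpret prob_space "sphere_uniform :: 'a measure" by (rule prob_space_sphere_uniform)
  show "integrable sphere_uniform (\<lambda>x. neg_ind u x)"
    "integrable sphere_uniform (\<lambda>x. neg_ind u x * neg_ind v x)"
    by (rule integrable_const_bound[where B=1]; simp add: neg_ind_def)+
qed

lemma integral_sphere_uniform_neg_ind:
  assumes "u \<noteq> 0"
  shows "(\<integral>x. neg_ind u x \<partial>sphere_uniform) = 1 / 2"
proof -
  have "(\<integral>x. neg_ind u x \<partial>sphere_uniform)
      = (\<integral>x. indicator {x \<in> space sphere_uniform. x \<bullet> u < 0} x \<partial>sphere_uniform)"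
    by (intro Bochner_Integration.integral_cong) (auto simp: neg_ind_def)
  then show ?thesis using measure_sphere_uniform_halfspace[OF assms] by simp
qed

lemma integral_sphere_uniform_neg_ind_mult:
  assumes "u \<noteq> 0" "v \<noteq> 0"
  shows "(\<integral>x. neg_ind u x * neg_ind v x \<partial>sphere_uniform) = 1 / 2 - Ang u v / (2 * pi)"
proof -
  have "(\<integral>x. neg_ind u x * neg_ind v x \<partial>sphere_uniform)
      = (\<integral>x. indicator {x \<in> space sphere_uniform. x \<bullet> u < 0 \<and> x \<bullet> v < 0} x \<partial>sphere_uniform)"
    by (intro Bochner_Integration.integral_cong) (auto simp: neg_ind_def)
  then show ?thesis using measure_sphere_uniform_two_halfspaces[OF assms] by simp
qed

text \<open>Expanding the product leaves 16 times a product of four indicators, two terms of the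
  form 4 times two indicators, and 1. The first integrates to the product of two factors 4 * (1 / 2
  - angle / (2 * pi)). Each of the other two integrates to 4 * (1 / 2) * (1 / 2) = 1, so the
  constant is 1 - 1 - 1 = -1.\<close>

lemma integral_sphere_uniform_sign_product:
  fixes u u' :: "'a::euclidean_space" and v v' :: "'b::euclidean_space"
  assumes nz: "u \<noteq> 0" "u' \<noteq> 0" "v \<noteq> 0" "v' \<noteq> 0"
  shows "(\<integral>a. \<integral>b. (4 * (neg_ind u a * neg_ind v b) - 1) * (4 * (neg_ind u' a * neg_ind v' b) - 1)
            \<partial>sphere_uniform \<partial>sphere_uniform)
       = (2 - 2 / pi * Ang u u') * (2 - 2 / pi * Ang v v') - 1"
proof -
  interpret A: prob_space "sphere_uniform :: 'a measure" by (rule prob_space_sphere_uniform)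
  interpret B: prob_space "sphere_uniform :: 'b measure" by (rule prob_space_sphere_uniform)
  let ?h = "1 / 2 - Ang v v' / (2 * pi)" and ?g = "1 / 2 - Ang u u' / (2 * pi)"
  have "(\<integral>b. (4 * (neg_ind u a * neg_ind v b) - 1) * (4 * (neg_ind u' a * neg_ind v' b) - 1) \<partial>sphere_uniform)
      = (\<integral>b. 16 * (neg_ind u a * neg_ind u' a) * (neg_ind v b * neg_ind v' b)
          - 4 * neg_ind u a * neg_ind v b - 4 * neg_ind u' a * neg_ind v' b + 1 \<partial>sphere_uniform)" for a
    by (simp add: algebra_simps)
  also have "\<dots> a = 16 * (neg_ind u a * neg_ind u' a) * ?h - 2 * neg_ind u a - 2 * neg_ind u' a + 1" for a
    by (simp add: integral_sphere_uniform_neg_ind integral_sphere_uniform_neg_ind_mult nz B.prob_space)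
  finally have inner: "(\<integral>b. (4 * (neg_ind u a * neg_ind v b) - 1) * (4 * (neg_ind u' a * neg_ind v' b) - 1) \<partial>sphere_uniform)
      = 16 * ?h * (neg_ind u a * neg_ind u' a) - 2 * neg_ind u a - 2 * neg_ind u' a + 1" for a
    by (simp only: mult_ac)
  have "(\<integral>a. 16 * ?h * (neg_ind u a * neg_ind u' a) - 2 * neg_ind u a - 2 * neg_ind u' a + 1 \<partial>sphere_uniform)
      = 16 * ?h * ?g - 1"
    by (simp add: integral_sphere_uniform_neg_ind integral_sphere_uniform_neg_ind_mult nz A.prob_space
        del: times_divide_eq_left times_divide_eq_right right_diff_distrib_numeral left_diff_distrib_numeral)
  also have "\<dots> = (2 - 2 / pi * Ang u u') * (2 - 2 / pi * Ang v v') - 1"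
    by (simp add: field_simps)
  finally show ?thesis unfolding inner .
qed

section \<open>Exchanging the spherical averages with the expectation\<close>

lemma abs_two_minus_Ang_le: "\<bar>2 - 2 / pi * Ang u v\<bar> \<le> 2"
proof -
  have "0 \<le> Ang u v" "Ang u v \<le> pi"
    using abs_cosine_le_1[of u v] unfolding Ang_def abs_le_iff
    by (auto intro!: arccos_lbound arccos_ubound)
  then show ?thesis by (simp add: abs_le_iff field_simps)
qed

text \<open>Here N plays the part of the law of \<open>(X 1 - X 2, Y 1 - Y 2)\<close>, so two
  independent differences become a point of the product of N with itself. After the exchange of
  integrals, the spherical integral is known for almost every such point.\<close>

lemma projection_averaged_square:
  fixes N :: "('a::euclidean_space \<times> 'b::euclidean_space) measure"
  assumes "prob_space N" and N: "sets N = sets borel"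
    and nz: "AE w in N. fst w \<noteq> 0 \<and> snd w \<noteq> 0"
  shows "(\<integral>a. \<integral>b. (4 * measure N {w \<in> space N. a \<bullet> fst w < 0 \<and> b \<bullet> snd w < 0} - 1)\<^sup>2
            \<partial>sphere_uniform \<partial>sphere_uniform)
       = (\<integral>z. (2 - 2 / pi * Ang (fst (fst z)) (fst (snd z))) *
               (2 - 2 / pi * Ang (snd (fst z)) (snd (snd z))) \<partial>(N \<Otimes>\<^sub>M N)) - 1"
proof -
  have N' [measurable_cong]: "sets N = sets (borel \<Otimes>\<^sub>M borel)"
    using N by (simp only: borel_prod)
  interpret N: prob_space N by fact
  interpret NN: pair_prob_space N N ..
  interpret A: prob_space "sphere_uniform :: 'a measure" by (rule prob_space_sphere_uniform)
  interpret B: prob_space "sphere_uniform :: 'b measure" by (rule prob_space_sphere_uniform)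
  define F where "F a b w = 4 * (neg_ind (fst w) a * neg_ind (snd w) b) - 1" for a :: 'a and b :: 'b and w
  define G where "G a b z = F a b (fst z) * F a b (snd z)" for a b z
  define R where "R z = (2 - 2 / pi * Ang (fst (fst z)) (fst (snd z))) *
               (2 - 2 / pi * Ang (snd (fst z)) (snd (snd z)))" for z :: "('a \<times> 'b) \<times> ('a \<times> 'b)"
  have F_bnd: "\<bar>F a b w\<bar> \<le> 3" for a b w by (auto simp: F_def neg_ind_def)
  have G_bnd: "\<bar>G a b z\<bar> \<le> 9" for a b z
    using mult_mono[OF F_bnd[of a b "fst z"] F_bnd[of a b "snd z"]] by (simp add: G_def abs_mult)
  have F_meas [measurable (raw)]: "(\<lambda>x. F (f x) (g x) (h x)) \<in> borel_measurable L"
    if [measurable]: "f \<in> borel_measurable L" "g \<in> borel_measurable L" "h \<in> measurable L N"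
    for f g h and L :: "'l measure"
  proof -
    have [measurable]: "h \<in> measurable L (borel \<Otimes>\<^sub>M borel)"
      using that(3) unfolding measurable_cong_sets[OF refl N'] .
    have "(\<lambda>x. fst (h x)) \<in> borel_measurable L" "(\<lambda>x. snd (h x)) \<in> borel_measurable L"
      by measurable
    with that show ?thesis
      unfolding F_def
      by (intro borel_measurable_diff borel_measurable_times borel_measurable_neg_ind
          borel_measurable_const)
  qed
  \<comment> \<open>\<open>4 * P - 1\<close> is the integral of \<open>F a b\<close>, and the square
    of an integral is the integral of \<open>G a b\<close>, the product over two independent
    copies.\<close>
  have sq: "(4 * measure N {w \<in> space N. a \<bullet> fst w < 0 \<and> b \<bullet> snd w < 0} - 1)\<^sup>2
      = (\<integral>z. G a b z \<partial>(N \<Otimes>\<^sub>M N))" for a b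
  proof -
    have Fi: "integrable N (F a b)"
      by (rule N.integrable_const_bound[where B=3]) (use F_bnd in auto)
    have "(\<integral>w. F a b w \<partial>N)
        = (\<integral>w. 4 * indicator {w \<in> space N. a \<bullet> fst w < 0 \<and> b \<bullet> snd w < 0} w - 1 \<partial>N)"
      by (intro Bochner_Integration.integral_cong) (auto simp: F_def neg_ind_def)
    also have "\<dots> = 4 * measure N {w \<in> space N. a \<bullet> fst w < 0 \<and> b \<bullet> snd w < 0} - 1"
    proof -
      have "{w \<in> space N. a \<bullet> fst w < 0 \<and> b \<bullet> snd w < 0} \<in> N.events" by measurable
      then show ?thesis
        by (subst Bochner_Integration.integral_diff)
          (simp_all add: N.prob_space N.emeasure_eq_measure Int_absorb2 sets.sets_into_space)
    qed
    finally have "(4 * measure N {w \<in> space N. a \<bullet> fst w < 0 \<and> b \<bullet> snd w < 0} - 1)\<^sup>2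
        = (\<integral>w. F a b w \<partial>N) * (\<integral>w. F a b w \<partial>N)"
      by (simp add: power2_eq_square)
    also have "\<dots> = (\<integral>w. \<integral>w'. G a b (w, w') \<partial>N \<partial>N)"
      by (simp add: G_def)
    also have "\<dots> = (\<integral>z. G a b z \<partial>(N \<Otimes>\<^sub>M N))"
      by (rule NN.integral_fst', rule NN.P.integrable_const_bound[where B=9])
        (use G_bnd in \<open>auto simp: G_def\<close>)
    finally show ?thesis .
  qed
  \<comment> \<open>Two exchanges follow: the integral over b moves inside the one over z, and then
    the integral over a does.\<close>
  have "(\<integral>a. \<integral>b. (4 * measure N {w \<in> space N. a \<bullet> fst w < 0 \<and> b \<bullet> snd w < 0} - 1)\<^sup>2
            \<partial>sphere_uniform \<partial>sphere_uniform)
      = (\<integral>a. \<integral>z. \<integral>b. G a b z \<partial>sphere_uniform \<partial>(N \<Otimes>\<^sub>M N) \<partial>sphere_uniform)"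
    unfolding sq
    by (intro Bochner_Integration.integral_cong refl Fubini_integral_bounded[where C=9])
      (auto simp: G_def[abs_def] intro: G_bnd[unfolded G_def], unfold_locales)
  also have "\<dots> = (\<integral>z. \<integral>a. \<integral>b. G a b z \<partial>sphere_uniform \<partial>sphere_uniform \<partial>(N \<Otimes>\<^sub>M N))"
  proof (rule Fubini_integral_bounded)
    show "(\<lambda>(a, z). \<integral>b. G a b z \<partial>sphere_uniform) \<in> borel_measurable (sphere_uniform \<Otimes>\<^sub>M (N \<Otimes>\<^sub>M N))"
      unfolding G_def by measurable
    show "\<bar>\<integral>b. G a b z \<partial>sphere_uniform\<bar> \<le> 9" for a z
      by (rule abs_integral_prob_le[OF prob_space_sphere_uniform G_bnd])
  qed unfold_locales
  also have "\<dots> = (\<integral>z. R z - 1 \<partial>(N \<Otimes>\<^sub>M N))"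
  proof (rule integral_cong_AE)
    show "(\<lambda>z. \<integral>a. \<integral>b. G a b z \<partial>sphere_uniform \<partial>sphere_uniform) \<in> borel_measurable (N \<Otimes>\<^sub>M N)"
      unfolding G_def by measurable
    show "(\<lambda>z. R z - 1) \<in> borel_measurable (N \<Otimes>\<^sub>M N)"
      unfolding R_def by measurable
    have "AE w in N. AE w' in N. (fst w \<noteq> 0 \<and> snd w \<noteq> 0) \<and> (fst w' \<noteq> 0 \<and> snd w' \<noteq> 0)"
      using nz by eventually_elim (use nz in auto)
    then have "AE z in N \<Otimes>\<^sub>M N. (fst (fst z) \<noteq> 0 \<and> snd (fst z) \<noteq> 0) \<and> (fst (snd z) \<noteq> 0 \<and> snd (snd z) \<noteq> 0)"
      by (intro NN.AE_pair_measure) (auto simp: split_beta)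
    then show "AE z in N \<Otimes>\<^sub>M N. (\<integral>a. \<integral>b. G a b z \<partial>sphere_uniform \<partial>sphere_uniform) = R z - 1"
      by eventually_elim (simp add: G_def F_def R_def integral_sphere_uniform_sign_product)
  qed
  also have "\<dots> = (\<integral>z. R z \<partial>(N \<Otimes>\<^sub>M N)) - 1"
  proof -
    have "\<bar>R z\<bar> \<le> 2 * 2" for z
      unfolding R_def abs_mult by (intro mult_mono abs_two_minus_Ang_le) auto
    then have "integrable (N \<Otimes>\<^sub>M N) R"
      by (intro NN.P.integrable_const_bound[where B=4]) (auto simp: R_def[abs_def])
    then show ?thesis by (simp add: NN.P.prob_space)
  qed
  finally show ?thesis by (simp add: R_def)
qed

section \<open>Independent copies with continuous projections almost surely differ\<close>

lemma AE_pair_neq_of_continuous_projections: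
  fixes P :: "'c measure" and g :: "'c \<Rightarrow> 'a::euclidean_space"
  assumes "prob_space P" and g [measurable]: "g \<in> borel_measurable P"
    and cont: "AE a in sphere_uniform. continuous_on UNIV (cdf (distr P borel (\<lambda>z. a \<bullet> g z)))"
  shows "AE z in P \<Otimes>\<^sub>M P. g (fst z) \<noteq> g (snd z)"
proof -
  interpret P: prob_space P by fact
  interpret PP: pair_prob_space P P ..
  interpret A: prob_space "sphere_uniform :: 'a measure" by (rule prob_space_sphere_uniform)
  \<comment> \<open>A property that holds almost everywhere for a probability measure holds at some
    point.\<close>
  obtain a where a: "continuous_on UNIV (cdf (distr P borel (\<lambda>z. a \<bullet> g z)))"
    using eventually_happens'[OF _ cont] A.ae_filter_bot by blast
  interpret D: real_distribution "distr P borel (\<lambda>z. a \<bullet> g z)"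
    by (rule P.real_distribution_distr) measurable
  have "AE w in P. AE w' in P. g w \<noteq> g w'"
  proof (rule AE_I2)
    fix w
    \<comment> \<open>Continuity of the distribution function means that the projected law has no
      atoms. For fixed w the projection of an independent copy thus almost surely avoids that of
      \<open>g w\<close>, and different projections force different points.\<close>
    have "isCont (cdf (distr P borel (\<lambda>z. a \<bullet> g z))) (a \<bullet> g w)"
      using a by (simp add: continuous_on_eq_continuous_at)
    then have "measure (distr P borel (\<lambda>z. a \<bullet> g z)) {a \<bullet> g w} = 0"
      by (simp add: D.isCont_cdf)
    then have "P.prob {w' \<in> space P. a \<bullet> g w' = a \<bullet> g w} = 0"
      by (subst (asm) measure_distr) (auto simp: vimage_def Int_def conj_commute)
    then have "AE w' in P. \<not> (a \<bullet> g w' = a \<bullet> g w)"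
      by (subst P.prob_Collect_eq_0[symmetric]) auto
    then show "AE w' in P. g w \<noteq> g w'" by eventually_elim auto
  qed
  then show ?thesis
    by (intro PP.AE_pair_measure) auto
qed

section \<open>Reduction of the theorem to the law of one difference\<close>

theorem theorem7p1:
  fixes M :: "'w measure"
    and P :: "((real^'p) \<times> (real^'q)) measure"
    and X :: "nat \<Rightarrow> 'w \<Rightarrow> real^'p"
    and Y :: "nat \<Rightarrow> 'w \<Rightarrow> real^'q"
  assumes "prob_space M"
    and indep: "prob_space.indep_vars M (\<lambda>_. borel) (\<lambda>i \<omega>. (X i \<omega>, Y i \<omega>)) {1..4}"
    and ident: "\<And>i. i \<in> {1..4} \<Longrightarrow> distr M borel (\<lambda>\<omega>. (X i \<omega>, Y i \<omega>)) = P"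
    and cont_X: "AE \<alpha> in sphere_uniform. continuous_on UNIV (cdf (distr P borel (\<lambda>z. \<alpha> \<bullet> fst z)))"
    and cont_Y: "AE \<beta> in sphere_uniform. continuous_on UNIV (cdf (distr P borel (\<lambda>z. \<beta> \<bullet> snd z)))"
  shows "(\<integral>\<alpha>. (\<integral>\<beta>.
            (4 * measure M {\<omega> \<in> space M. \<alpha> \<bullet> (X 1 \<omega> - X 2 \<omega>) < 0 \<and> \<beta> \<bullet> (Y 1 \<omega> - Y 2 \<omega>) < 0} - 1)\<^sup>2
            \<partial>sphere_uniform) \<partial>sphere_uniform)
       = (\<integral>\<omega>. (2 - 2 / pi * Ang (X 1 \<omega> - X 2 \<omega>) (X 3 \<omega> - X 4 \<omega>)) *
               (2 - 2 / pi * Ang (Y 1 \<omega> - Y 2 \<omega>) (Y 3 \<omega> - Y 4 \<omega>)) \<partial>M) - 1"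
proof -
  interpret prob_space M by fact
  define Z where "Z i \<omega> = (X i \<omega>, Y i \<omega>)" for i \<omega>
  define W where "W i j \<omega> = Z i \<omega> - Z j \<omega>" for i j \<omega>
  define N where "N = distr M borel (W 1 2)"
  have rv: "random_variable borel (Z i)" if "i \<in> {1..4}" for i
    using indep that by (simp add: indep_vars_def Z_def[abs_def])
  have Z [measurable]: "Z 1 \<in> borel_measurable M" "Z 2 \<in> borel_measurable M"
    "Z 3 \<in> borel_measurable M" "Z 4 \<in> borel_measurable M"
    by (auto intro!: rv)
  have W [measurable]: "W 1 2 \<in> borel_measurable M" "W 3 4 \<in> borel_measurable M"
    unfolding W_def[abs_def] by measurable
  have indepZ: "indep_vars (\<lambda>_. borel) Z {1..4}"
    using indep by (simp add: Z_def[abs_def])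
  have P: "distr M borel (Z i) = P" if "i \<in> {1..4}" for i
    using ident[OF that] by (simp add: Z_def[abs_def])
  have P_prob: "prob_space P"
    using prob_space_distr[OF Z(1)] P[of 1] by simp
  have P_sets [measurable_cong]: "sets P = sets borel"
    using P[of 1] by auto
  have pair: "distr M (borel \<Otimes>\<^sub>M borel) (\<lambda>\<omega>. (Z i \<omega>, Z j \<omega>)) = P \<Otimes>\<^sub>M P"
    if "i \<in> {1..4}" "j \<in> {1..4}" "i \<noteq> j" for i j
  proof -
    \<comment> \<open>Pairwise independence is the independence of blocks for the singleton blocks
      {i} and {j}, followed by evaluation.\<close>
    have "indep_var borel ((\<lambda>f. f i) \<circ> (\<lambda>\<omega>. restrict (\<lambda>i. Z i \<omega>) {i}))
        borel ((\<lambda>f. f j) \<circ> (\<lambda>\<omega>. restrict (\<lambda>i. Z i \<omega>) {j}))"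
      by (rule indep_var_compose[OF indep_var_restrict[OF indepZ]]) (use that in auto)
    then have "indep_var borel (Z i) borel (Z j)" by (simp add: comp_def)
    then show ?thesis
      using that by (simp add: indep_var_distribution_eq P)
  qed
  have law: "distr M borel (W i j) = distr (P \<Otimes>\<^sub>M P) borel (\<lambda>(x, y). x - y)"
    if ij: "i \<in> {1..4}" "j \<in> {1..4}" "i \<noteq> j" for i j
  proof -
    have [measurable]: "Z i \<in> borel_measurable M" "Z j \<in> borel_measurable M"
      using ij rv by auto
    show ?thesis
      unfolding pair[OF ij, symmetric]
      by (subst distr_distr) (auto simp: comp_def W_def[abs_def])
  qed
  \<comment> \<open>The two differences depend on the disjoint index blocks {1, 2} and {3,
    4}.\<close>
  have indepW: "indep_var borel (W 1 2) borel (W 3 4)"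
  proof -
    have "indep_var borel ((\<lambda>f. f 1 - f 2) \<circ> (\<lambda>\<omega>. restrict (\<lambda>i. Z i \<omega>) {1, 2}))
        borel ((\<lambda>f. f 3 - f 4) \<circ> (\<lambda>\<omega>. restrict (\<lambda>i. Z i \<omega>) {3, 4}))"
      by (rule indep_var_compose[OF indep_var_restrict[OF indepZ]]) auto
    then show ?thesis by (simp add: comp_def W_def[abs_def])
  qed
  \<comment> \<open>By \<open>law\<close>, the distribution of \<open>W i j\<close> is the same for
    every pair of distinct indices, so both differences have law N.\<close>
  have WW: "distr M (borel \<Otimes>\<^sub>M borel) (\<lambda>\<omega>. (W 1 2 \<omega>, W 3 4 \<omega>)) = N \<Otimes>\<^sub>M N"
    using indepW law[of 1 2] law[of 3 4] by (simp add: indep_var_distribution_eq N_def)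
  have N_prob: "prob_space N"
    unfolding N_def by (rule prob_space_distr) measurable
  have N_sets: "sets N = sets borel"
    by (simp add: N_def)
  have "fst \<in> borel_measurable P" "snd \<in> borel_measurable P"
    unfolding measurable_cong_sets[OF P_sets refl]
    by (simp_all add: borel_measurable_continuous_onI continuous_on_fst continuous_on_snd)
  then have "AE z in P \<Otimes>\<^sub>M P. fst (fst z) \<noteq> fst (snd z)" "AE z in P \<Otimes>\<^sub>M P. snd (fst z) \<noteq> snd (snd z)"
    using AE_pair_neq_of_continuous_projections[OF P_prob _ cont_X]
      AE_pair_neq_of_continuous_projections[OF P_prob _ cont_Y] by auto
  then have "AE z in P \<Otimes>\<^sub>M P. fst (case z of (x, y) \<Rightarrow> x - y) \<noteq> 0 \<and> snd (case z of (x, y) \<Rightarrow> x - y) \<noteq> 0"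
    by eventually_elim (simp add: split_beta)
  moreover have "(\<lambda>(x, y). x - y) \<in> borel_measurable (P \<Otimes>\<^sub>M P)"
    by measurable
  moreover have "N = distr (P \<Otimes>\<^sub>M P) borel (\<lambda>(x, y). x - y)"
    unfolding N_def by (rule law) auto
  moreover have "{w \<in> space borel. fst w \<noteq> 0 \<and> snd w \<noteq> 0} \<in> sets (borel :: ((real^'p) \<times> (real^'q)) measure)"
    unfolding borel_prod[symmetric] by measurable
  ultimately have nz: "AE w in N. fst w \<noteq> 0 \<and> snd w \<noteq> 0"
    by (simp only: AE_distr_iff)
  \<comment> \<open>The probability on the left-hand side of the theorem depends only on the law N
    of the first difference.\<close>
  have meas: "measure M {\<omega> \<in> space M. \<alpha> \<bullet> (X 1 \<omega> - X 2 \<omega>) < 0 \<and> \<beta> \<bullet> (Y 1 \<omega> - Y 2 \<omega>) < 0}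
      = measure N {w \<in> space N. \<alpha> \<bullet> fst w < 0 \<and> \<beta> \<bullet> snd w < 0}" for \<alpha> \<beta>
  proof -
    have "{w \<in> space borel. \<alpha> \<bullet> fst w < 0 \<and> \<beta> \<bullet> snd w < 0} \<in> sets (borel :: ((real^'p) \<times> (real^'q)) measure)"
      unfolding borel_prod[symmetric] by measurable
    then have "measure N {w \<in> space N. \<alpha> \<bullet> fst w < 0 \<and> \<beta> \<bullet> snd w < 0}
        = prob (W 1 2 -` {w. \<alpha> \<bullet> fst w < 0 \<and> \<beta> \<bullet> snd w < 0} \<inter> space M)"
      unfolding N_def using measure_distr[OF W(1)] by simp
    then show ?thesis
      by (auto simp: W_def Z_def vimage_def Int_def intro!: arg_cong[where f=prob])
  qed
  have "(\<integral>\<omega>. (2 - 2 / pi * Ang (X 1 \<omega> - X 2 \<omega>) (X 3 \<omega> - X 4 \<omega>)) *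
               (2 - 2 / pi * Ang (Y 1 \<omega> - Y 2 \<omega>) (Y 3 \<omega> - Y 4 \<omega>)) \<partial>M)
      = (\<integral>z. (2 - 2 / pi * Ang (fst (fst z)) (fst (snd z))) *
               (2 - 2 / pi * Ang (snd (fst z)) (snd (snd z))) \<partial>(N \<Otimes>\<^sub>M N))"
  proof -
    have "(\<lambda>z. (2 - 2 / pi * Ang (fst (fst z)) (fst (snd z))) *
               (2 - 2 / pi * Ang (snd (fst z)) (snd (snd z))))
        \<in> borel_measurable (borel \<Otimes>\<^sub>M borel :: (((real^'p) \<times> (real^'q)) \<times> ((real^'p) \<times> (real^'q))) measure)"
      unfolding borel_prod[symmetric] by measurable
    moreover have "(\<lambda>\<omega>. (W 1 2 \<omega>, W 3 4 \<omega>)) \<in> measurable M (borel \<Otimes>\<^sub>M borel)"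
      by measurable
    ultimately show ?thesis
      unfolding WW[symmetric] by (simp add: integral_distr) (simp add: W_def Z_def)
  qed
  then show ?thesis
    unfolding meas by (simp only: projection_averaged_square[OF N_prob N_sets nz])
qed

end
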